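(* Let $\mathcal{L}=(F,\Phi,D,\phi)$ be a software product line, let $IDB$ be a finite set of Datalog rules, and let $\widehat{EDB}$ be a finite set of lifted facts, i.e. pairs $(f,pc)$ with $f$ a Datalog fact and $pc$ a propositional formula (feature expression) over the feature set $F$. Let $\widehat{\mathrm{infer}}(\widehat{EDB})$ denote the output of the lifted inference algorithm, and for a set $E$ of facts let $\mathrm{infer}(E)$ denote the output of the ordinary (forward chaining) inference algorithm, both run with the rules $IDB$. Then for every valid configuration $\rho\in\mathrm{Conf}(\mathcal{L})$, $$\widehat{\mathrm{infer}}(\widehat{EDB})\big|_{\rho}\;=\;\mathrm{infer}\big(\widehat{EDB}\big|_{\rho}\big).$$
   Context: **Product lines.** A software product line is a tuple $\mathcal{L}=(F,\Phi,D,\phi)$, where $F$ is a finite set of features (used as propositional variables), $\Phi$ is a propositional formula over $F$ (the feature model), $D$ is a set of program elements, and $\phi$ is a total function from $D$ to propositional formulas over $F$. A configuration is a subset $\rho\subseteq F$. $\mathrm{Conf}(\mathcal{L})$ is the set of valid configurations defined by $\Phi$, i.e. those $\rho$ for which the truth assignment making exactly the features in $\rho$ true satisfies $\Phi$. When a configuration $\rho$ is used as a formula, it stands for $\bigwedge_{x\in\rho}x\wedge\bigwedge_{x\in F\setminus\rho}\neg x$. For a propositional formula $\psi$, $\mathrm{sat}(\psi)$ means that $\psi$ is satisfiable. **Datalog.** Fix finite sets $S$ of constants, $V$ of variables and $P$ of predicate symbols. A term is a constant or a variable. A predicate expression is an $m$-ary predicate symbol applied to $m$ terms. A fact is a predicate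 expression all of whose arguments are constants. A rule is $C\ \text{:-}\ s_1,\dots,s_n$, where $C$ (the head) and $s_1,\dots,s_n$ (the premises) are predicate expressions. For a variable assignment $\gamma:V\to S$ and a predicate expression $e$, $[\gamma]e$ is the fact obtained by replacing each variable $v$ in $e$ by $\gamma(v)$. **Ordinary inference.** Given the rules $IDB$ and a set $EDB$ of facts, $\mathrm{infer}(EDB)$ is computed by repeating the following pass until the flag "fixpoint" is True at the end of a pass, and then returning $EDB$. Set fixpoint = True. For each rule $(C\ \text{:-}\ s_1,\dots,s_n)\in IDB$ and each choice of an assignment $\gamma$ and facts $f_1,\dots,f_n\in EDB$ with $[\gamma]s_i=f_i$ for all $i$: if $[\gamma]C\notin EDB$, set fixpoint = False and replace $EDB$ by $EDB\cup\{[\gamma]C\}$. **Lifted facts and restriction.** A lifted fact is a pair $(f,pc)$ with $f$ a fact and $pc$ (its presence condition) a propositional formula over $F$. For a set $\widehat{E}$ of lifted facts and a feature expression $\rho$, $$\widehat{E}\big|_{\rho}=\{f \mid (f,pc)\in\widehat{E}\ \text{ and }\ \mathrm{sat}(pc\wedge\rho)\}.$$ **Lifted inference.** Given the rules $IDB$ and a set $\widehat{EDB}$ of lifted facts, $\widehat{\mathrm{infer}}(\widehat{EDB})$ is computed by repeating the following pass until the flag "fixpoint" is True at the end of a pass, and then returning $\widehat{EDB}$. Set fixpoint = True. For each rule $(C\ \text{:-}\ s_1,\dots,s_n)\in IDB$ and each choice of an assignment $\gamma$ and lifted facts $(f_1,pc_1),\dots,(f_n,pc_n)\in\widehat{EDB}$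 with $[\gamma]s_i=f_i$ for all $i$, put $pc_c=pc_1\wedge\dots\wedge pc_n$ and do the following. - If $pc_c$ is not satisfiable, do nothing. - If $pc_c$ is satisfiable and $([\gamma]C,pc_c)\in\widehat{EDB}$, do nothing. - If $pc_c$ is satisfiable and $([\gamma]C,pc_c)\notin\widehat{EDB}$, set fixpoint = False. Then, if there is some $pc_d$ with $([\gamma]C,pc_d)\in\widehat{EDB}$ (so $pc_d\neq pc_c$), remove $([\gamma]C,pc_d)$ from $\widehat{EDB}$ and add $([\gamma]C,pc_c\vee pc_d)$; if there is no such $pc_d$, add $([\gamma]C,pc_c)$ to $\widehat{EDB}$.
   Formalization: The lifted algorithm need not terminate (e.g. facts (p,a),(q,b) with rule p :- p,q), so its output may be undefined; the equation is proved for every output of every terminating run, in any processing order. *)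

theory Defs
  imports "HOL-Library.FuncSet"
begin

datatype 'x pform =
    Top
  | Bot
  | Atom 'x
  | Neg "'x pform"
  | Conj "'x pform" "'x pform"
  | Disj "'x pform" "'x pform"
  | Imp "'x pform" "'x pform"

abbreviation atoms :: "'x pform \<Rightarrow> 'x set" where
  "atoms \<equiv> set_pform"

text \<open>A truth assignment is given by the set of atoms that it makes true.\<close>

fun holds :: "'x set \<Rightarrow> 'x pform \<Rightarrow> bool" where
  "holds \<nu> Top \<longleftrightarrow> True"
| "holds \<nu> Bot \<longleftrightarrow> False"
| "holds \<nu> (Atom x) \<longleftrightarrow> x \<in> \<nu>"
| "holds \<nu> (Neg a) \<longleftrightarrow> \<not> holds \<nu> a"
| "holds \<nu> (Conj a b) \<longleftrightarrow> holds \<nu> a \<and> holds \<nu> b"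
| "holds \<nu> (Disj a b) \<longleftrightarrow> holds \<nu> a \<or> holds \<nu> b"
| "holds \<nu> (Imp a b) \<longleftrightarrow> (holds \<nu> a \<longrightarrow> holds \<nu> b)"

definition sat :: "'x pform \<Rightarrow> bool" where
  "sat a \<longleftrightarrow> (\<exists>\<nu>. holds \<nu> a)"

text \<open>
  The conjunction of a single formula is that formula itself, syntactically.  This matters
  because presence conditions are compared as formulas below.
\<close>

fun conj_list :: "'x pform list \<Rightarrow> 'x pform" where
  "conj_list [] = Top"
| "conj_list [a] = a"
| "conj_list (a # b # as) = Conj a (conj_list (b # as))"

record ('x, 'd) product_line =
  features :: "'x set"
  feature_model :: "'x pform"
  elements :: "'d set"
  annotation :: "'d \<Rightarrow> 'x pform"

definition wf_product_line :: "('x, 'd) product_line \<Rightarrow> bool" where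
  "wf_product_line L \<longleftrightarrow>
     finite (features L) \<and>
     atoms (feature_model L) \<subseteq> features L \<and>
     (\<forall>d \<in> elements L. atoms (annotation L d) \<subseteq> features L)"

definition Conf :: "('x, 'd) product_line \<Rightarrow> 'x set set" where
  "Conf L = {\<rho>. \<rho> \<subseteq> features L \<and> holds \<rho> (feature_model L)}"

text \<open>
  An arbitrary enumeration of a finite set, used to write a conjunction over a set as a formula.
\<close>

definition enumeration :: "'x set \<Rightarrow> 'x list" where
  "enumeration A = (SOME xs. set xs = A \<and> distinct xs)"

definition config_form :: "'x set \<Rightarrow> 'x set \<Rightarrow> 'x pform" where
  "config_form F \<rho> =
     Conj (conj_list (map Atom (enumeration \<rho>)))
          (conj_list (map (\<lambda>x. Neg (Atom x)) (enumeration (F - \<rho>))))"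

record ('c, 'v, 'p) signature =
  constants :: "'c set"
  variables :: "'v set"
  predicates :: "'p set"
  arity :: "'p \<Rightarrow> nat"

datatype ('c, 'v) dterm = Const 'c | Var 'v

datatype ('c, 'v, 'p) pexpr = Pred 'p "('c, 'v) dterm list"

datatype ('c, 'v, 'p) rule =
  Rule (head: "('c, 'v, 'p) pexpr") (prems: "('c, 'v, 'p) pexpr list")

definition wf_signature :: "('c, 'v, 'p) signature \<Rightarrow> bool" where
  "wf_signature \<Sigma> \<longleftrightarrow>
     finite (constants \<Sigma>) \<and> finite (variables \<Sigma>) \<and> finite (predicates \<Sigma>)"

fun wf_pexpr :: "('c, 'v, 'p) signature \<Rightarrow> ('c, 'v, 'p) pexpr \<Rightarrow> bool" where
  "wf_pexpr \<Sigma> (Pred p ts) \<longleftrightarrow>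
     p \<in> predicates \<Sigma> \<and> length ts = arity \<Sigma> p \<and>
     set ts \<subseteq> Const ` constants \<Sigma> \<union> Var ` variables \<Sigma>"

fun wf_fact :: "('c, 'v, 'p) signature \<Rightarrow> ('c, 'v, 'p) pexpr \<Rightarrow> bool" where
  "wf_fact \<Sigma> (Pred p ts) \<longleftrightarrow>
     p \<in> predicates \<Sigma> \<and> length ts = arity \<Sigma> p \<and> set ts \<subseteq> Const ` constants \<Sigma>"

definition wf_rule :: "('c, 'v, 'p) signature \<Rightarrow> ('c, 'v, 'p) rule \<Rightarrow> bool" where
  "wf_rule \<Sigma> r \<longleftrightarrow> wf_pexpr \<Sigma> (head r) \<and> (\<forall>s \<in> set (prems r). wf_pexpr \<Sigma> s)"

definition assignments :: "('c, 'v, 'p) signature \<Rightarrow> ('v \<Rightarrow> 'c) set" where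
  "assignments \<Sigma> = (variables \<Sigma> \<rightarrow>\<^sub>E constants \<Sigma>)"

fun inst_term :: "('v \<Rightarrow> 'c) \<Rightarrow> ('c, 'v) dterm \<Rightarrow> ('c, 'v) dterm" where
  "inst_term \<gamma> (Const c) = Const c"
| "inst_term \<gamma> (Var v) = Const (\<gamma> v)"

fun inst :: "('v \<Rightarrow> 'c) \<Rightarrow> ('c, 'v, 'p) pexpr \<Rightarrow> ('c, 'v, 'p) pexpr" where
  "inst \<gamma> (Pred p ts) = Pred p (map (inst_term \<gamma>) ts)"

text \<open>
  Both inference algorithms repeat a pass over all choices of a rule, an assignment and matching
  facts, while the set of facts is being updated.  The order of the choices is left open, and so
  is whether the facts range over the set as it was when the loop was entered or over its current
  value.  The definition admits every such schedule.  A state of a pass consists of the choices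
  processed so far, the values that the set of facts has had during the pass, the flag, and the
  current set of facts.  A choice may be processed (once) if its facts have occurred during the
  pass, and it has to be processed if its facts have been present throughout the pass.
  The argument \<open>choices\<close> yields the choices available in a set of facts, and \<open>body\<close> is the effect
  of processing one choice on the flag and the set of facts; it is a relation since the lifted
  algorithm does not determine which presence condition it replaces.
\<close>

inductive pass ::
  "('e set \<Rightarrow> 'k set) \<Rightarrow> ('k \<Rightarrow> bool \<times> 'e set \<Rightarrow> bool \<times> 'e set \<Rightarrow> bool) \<Rightarrow> 'e set \<Rightarrow>
   'k set \<Rightarrow> 'e set set \<Rightarrow> bool \<Rightarrow> 'e set \<Rightarrow> bool"
  for choices body E0 where
  start: "pass choices body E0 {} {E0} True E0"
| step: "\<lbrakk> pass choices body E0 done seen flag E;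
           k \<in> choices (\<Union>seen); k \<notin> done;
           body k (flag, E) (flag', E') \<rbrakk>
         \<Longrightarrow> pass choices body E0 (insert k done) (insert E' seen) flag' E'"

definition full_pass ::
  "('e set \<Rightarrow> 'k set) \<Rightarrow> ('k \<Rightarrow> bool \<times> 'e set \<Rightarrow> bool \<times> 'e set \<Rightarrow> bool) \<Rightarrow>
   'e set \<Rightarrow> bool \<Rightarrow> 'e set \<Rightarrow> bool" where
  "full_pass choices body E flag E' \<longleftrightarrow>
     (\<exists>processed seen. pass choices body E processed seen flag E' \<and> choices (\<Inter>seen) \<subseteq> processed)"

inductive returns ::
  "('e set \<Rightarrow> 'k set) \<Rightarrow> ('k \<Rightarrow> bool \<times> 'e set \<Rightarrow> bool \<times> 'e set \<Rightarrow> bool) \<Rightarrow>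
   'e set \<Rightarrow> 'e set \<Rightarrow> bool"
  for choices body where
  stop: "full_pass choices body E True E' \<Longrightarrow> returns choices body E E'"
| again: "\<lbrakk> full_pass choices body E False E'; returns choices body E' R \<rbrakk>
          \<Longrightarrow> returns choices body E R"

definition choices ::
  "('c, 'v, 'p) signature \<Rightarrow> ('c, 'v, 'p) rule set \<Rightarrow> ('c, 'v, 'p) pexpr set \<Rightarrow>
   (('c, 'v, 'p) rule \<times> ('v \<Rightarrow> 'c) \<times> ('c, 'v, 'p) pexpr list) set" where
  "choices \<Sigma> IDB E =
     {(r, \<gamma>, fs). r \<in> IDB \<and> \<gamma> \<in> assignments \<Sigma> \<and> set fs \<subseteq> E \<and> map (inst \<gamma>) (prems r) = fs}"

inductive body ::
  "('c, 'v, 'p) rule \<times> ('v \<Rightarrow> 'c) \<times> ('c, 'v, 'p) pexpr list \<Rightarrow>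
   bool \<times> ('c, 'v, 'p) pexpr set \<Rightarrow> bool \<times> ('c, 'v, 'p) pexpr set \<Rightarrow> bool" where
  present: "inst \<gamma> (head r) \<in> E \<Longrightarrow> body (r, \<gamma>, fs) (flag, E) (flag, E)"
| add: "inst \<gamma> (head r) \<notin> E \<Longrightarrow>
        body (r, \<gamma>, fs) (flag, E) (False, E \<union> {inst \<gamma> (head r)})"

text \<open>For finitely many rules and facts the algorithm terminates, and its output is unique.\<close>

definition infer ::
  "('c, 'v, 'p) signature \<Rightarrow> ('c, 'v, 'p) rule set \<Rightarrow>
   ('c, 'v, 'p) pexpr set \<Rightarrow> ('c, 'v, 'p) pexpr set" where
  "infer \<Sigma> IDB E = (THE R. returns (choices \<Sigma> IDB) body E R)"

type_synonym ('c, 'v, 'p, 'x) lifted_fact = "('c, 'v, 'p) pexpr \<times> 'x pform"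

definition wf_lifted_fact ::
  "('c, 'v, 'p) signature \<Rightarrow> 'x set \<Rightarrow> ('c, 'v, 'p, 'x) lifted_fact \<Rightarrow> bool" where
  "wf_lifted_fact \<Sigma> F lf \<longleftrightarrow> wf_fact \<Sigma> (fst lf) \<and> atoms (snd lf) \<subseteq> F"

definition restriction ::
  "('c, 'v, 'p, 'x) lifted_fact set \<Rightarrow> 'x pform \<Rightarrow> ('c, 'v, 'p) pexpr set" where
  "restriction E \<psi> = {f. \<exists>pc. (f, pc) \<in> E \<and> sat (Conj pc \<psi>)}"

definition lifted_choices ::
  "('c, 'v, 'p) signature \<Rightarrow> ('c, 'v, 'p) rule set \<Rightarrow> ('c, 'v, 'p, 'x) lifted_fact set \<Rightarrow>
   (('c, 'v, 'p) rule \<times> ('v \<Rightarrow> 'c) \<times> ('c, 'v, 'p, 'x) lifted_fact list) set" where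
  "lifted_choices \<Sigma> IDB E =
     {(r, \<gamma>, lfs). r \<in> IDB \<and> \<gamma> \<in> assignments \<Sigma> \<and> set lfs \<subseteq> E \<and>
        map (inst \<gamma>) (prems r) = map fst lfs}"

inductive lifted_body ::
  "('c, 'v, 'p) rule \<times> ('v \<Rightarrow> 'c) \<times> ('c, 'v, 'p, 'x) lifted_fact list \<Rightarrow>
   bool \<times> ('c, 'v, 'p, 'x) lifted_fact set \<Rightarrow> bool \<times> ('c, 'v, 'p, 'x) lifted_fact set \<Rightarrow> bool"
  where
  unsat: "\<not> sat (conj_list (map snd lfs)) \<Longrightarrow> lifted_body (r, \<gamma>, lfs) (flag, E) (flag, E)"
| present: "\<lbrakk> pcc = conj_list (map snd lfs); sat pcc; (inst \<gamma> (head r), pcc) \<in> E \<rbrakk>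
            \<Longrightarrow> lifted_body (r, \<gamma>, lfs) (flag, E) (flag, E)"
| merge: "\<lbrakk> pcc = conj_list (map snd lfs); sat pcc; C = inst \<gamma> (head r);
            (C, pcc) \<notin> E; (C, pcd) \<in> E \<rbrakk>
          \<Longrightarrow> lifted_body (r, \<gamma>, lfs) (flag, E)
                (False, (E - {(C, pcd)}) \<union> {(C, Disj pcc pcd)})"
| add: "\<lbrakk> pcc = conj_list (map snd lfs); sat pcc; C = inst \<gamma> (head r);
          \<nexists>pcd. (C, pcd) \<in> E \<rbrakk>
        \<Longrightarrow> lifted_body (r, \<gamma>, lfs) (flag, E) (False, E \<union> {(C, pcc)})"

text \<open>
  \<open>lifted_infer \<Sigma> IDB E R\<close> means that some run of the lifted algorithm on \<open>E\<close> terminates with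
  output \<open>R\<close>.  This is a relation rather than a function: the presence conditions in the output
  depend on the schedule, and there are inputs without a terminating run, for example \<open>{(p, a), (q, b)}\<close>
  with the rule \<open>p :- p, q\<close>, where every pass adds another disjunct to the presence condition of
  \<open>p\<close>.
\<close>

definition lifted_infer ::
  "('c, 'v, 'p) signature \<Rightarrow> ('c, 'v, 'p) rule set \<Rightarrow>
   ('c, 'v, 'p, 'x) lifted_fact set \<Rightarrow> ('c, 'v, 'p, 'x) lifted_fact set \<Rightarrow> bool" where
  "lifted_infer \<Sigma> IDB E R \<longleftrightarrow> returns (lifted_choices \<Sigma> IDB) lifted_body E R"

end

theory Submission
  imports Defs
begin

text \<open>
  Both algorithms compute the least set of facts that contains the input and is closed under the
  rules.  Let \<open>holds_in \<rho> E\<close> be the set of facts having in \<open>E\<close> a presence condition true at \<open>\<rho>\<close>;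
  over the features of the product line this is the restriction to \<open>\<rho>\<close>.  A step of the lifted
  algorithm never shrinks \<open>holds_in \<rho> E\<close>, since merging weakens presence conditions, and it only adds
  facts that are derivable from \<open>holds_in \<rho> E\<close>, since a conjunction of presence conditions is true
  at \<open>\<rho>\<close> only if the premises all hold there.  A pass that ends with the flag still set has
  changed nothing, so it witnesses that the current set is closed under the rules.  Ordinary
  inference moreover terminates, because only finitely many instances of heads can be added.
\<close>

section \<open>Formulas\<close>

lemma holds_cong:
  assumes "\<nu> \<inter> F = \<mu> \<inter> F" "atoms a \<subseteq> F"
  shows "holds \<nu> a \<longleftrightarrow> holds \<mu> a"
proof -
  have "x \<in> \<nu> \<longleftrightarrow> x \<in> \<mu>" if "x \<in> F" for x
    using that assms(1) by blast
  then show ?thesis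
    using assms(2) by (induction a) simp_all
qed

lemma holds_conj_list: "holds \<nu> (conj_list xs) \<longleftrightarrow> (\<forall>a \<in> set xs. holds \<nu> a)"
  by (induction xs rule: conj_list.induct) auto

lemma atoms_conj_list: "atoms (conj_list xs) = (\<Union>a \<in> set xs. atoms a)"
  by (induction xs rule: conj_list.induct) auto

lemma set_enumeration:
  assumes "finite A"
  shows "set (enumeration A) = A"
  unfolding enumeration_def
  by (rule someI2_ex) (use finite_distinct_list[OF assms] in auto)

lemma holds_config_form:
  assumes "finite F" "\<rho> \<subseteq> F"
  shows "holds \<nu> (config_form F \<rho>) \<longleftrightarrow> \<nu> \<inter> F = \<rho>"
  using assms finite_subset[OF assms(2,1)]
  by (auto simp: config_form_def holds_conj_list set_enumeration)

text \<open>The configuration formula forces every model to agree with \<open>\<rho>\<close> on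
  \<open>F\<close>, and \<open>a\<close> cannot distinguish models that agree there. So
  satisfiability collapses to truth at the single point \<open>\<rho>\<close>.\<close>

lemma sat_Conj_config_form:
  assumes "finite F" "\<rho> \<subseteq> F" "atoms a \<subseteq> F"
  shows "sat (Conj a (config_form F \<rho>)) \<longleftrightarrow> holds \<rho> a"
proof -
  have \<rho>: "\<rho> \<inter> F = \<rho>"
    using assms(2) by blast
  have "holds \<nu> a \<longleftrightarrow> holds \<rho> a" if "\<nu> \<inter> F = \<rho>" for \<nu>
    by (rule holds_cong[OF _ assms(3)]) (simp add: that \<rho>)
  moreover have "sat (Conj a (config_form F \<rho>)) \<longleftrightarrow> (\<exists>\<nu>. holds \<nu> a \<and> \<nu> \<inter> F = \<rho>)"
    by (simp add: sat_def holds_config_form[OF assms(1,2)])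
  ultimately show ?thesis
    using \<rho> by blast
qed

section \<open>Passes\<close>

text \<open>A choice may use facts from any earlier value of the set, even facts removed since, so
  the invariant must bound \<open>\<Union>seen\<close> and not only the current set. Monotonicity of
  \<open>ch\<close> then makes each processed choice one over \<open>U\<close>.\<close>

lemma pass_subset:
  assumes "pass ch b E0 ks seen flag E"
    and "mono ch" and "E0 \<subseteq> U"
    and "\<And>k fl A fl' A'. \<lbrakk> k \<in> ch U; A \<subseteq> U; b k (fl, A) (fl', A') \<rbrakk> \<Longrightarrow> A' \<subseteq> U"
  shows "E \<subseteq> U \<and> \<Union>seen \<subseteq> U"
  using assms(1)
proof induction
  case start
  then show ?case using assms(3) by simp
next
  case (step ks seen flag E k flag' E')
  then have "k \<in> ch U"
    using monoD[OF assms(2), of "\<Union>seen" U] by blast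
  then have "E' \<subseteq> U"
    using step assms(4) by blast
  then show ?case using step.IH by simp
qed

lemma returns_subset:
  assumes "returns ch b E0 R"
    and "mono ch" and "E0 \<subseteq> U"
    and "\<And>k fl A fl' A'. \<lbrakk> k \<in> ch U; A \<subseteq> U; b k (fl, A) (fl', A') \<rbrakk> \<Longrightarrow> A' \<subseteq> U"
  shows "R \<subseteq> U"
  using assms(1,3)
proof induction
  case (stop E E')
  then obtain processed seen where "pass ch b E processed seen True E'"
    unfolding full_pass_def by blast
  then have "E' \<subseteq> U \<and> \<Union>seen \<subseteq> U"
    by (rule pass_subset[OF _ assms(2) stop(2)]) (rule assms(4))
  then show ?case ..
next
  case (again E E' R)
  then obtain processed seen where "pass ch b E processed seen False E'"
    unfolding full_pass_def by blast
  then have "E' \<subseteq> U \<and> \<Union>seen \<subseteq> U"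
    by (rule pass_subset[OF _ assms(2) again.prems]) (rule assms(4))
  then show ?case using again.IH by blast
qed

text \<open>The observation \<open>g\<close> is needed because a merge removes a pair, so lifted
  sets do not grow themselves. It is the identity for ordinary inference and
  \<open>holds_in \<rho>\<close> for the lifted one.\<close>

lemma pass_mono:
  assumes "pass ch b E0 ks seen flag E"
    and "\<And>k fl A fl' A'. b k (fl, A) (fl', A') \<Longrightarrow> g A \<subseteq> (g A' :: 'f set)"
  shows "g E0 \<subseteq> g E"
  using assms(1)
proof induction
  case start
  show ?case ..
next
  case (step ks seen flag E k flag' E')
  show ?case by (rule subset_trans[OF step.IH assms(2)[OF step.hyps(4)]])
qed

lemma returns_mono:
  assumes "returns ch b E0 R"
    and "\<And>k fl A fl' A'. b k (fl, A) (fl', A') \<Longrightarrow> g A \<subseteq> (g A' :: 'f set)"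
  shows "g E0 \<subseteq> g R"
  using assms(1)
proof induction
  case (stop E E')
  then obtain processed seen where "pass ch b E processed seen True E'"
    unfolding full_pass_def by blast
  then show ?case
    by (rule pass_mono) (rule assms(2))
next
  case (again E E' R)
  then obtain processed seen where "pass ch b E processed seen False E'"
    unfolding full_pass_def by blast
  then have "g E \<subseteq> g E'"
    by (rule pass_mono) (rule assms(2))
  then show ?case using again.IH by (rule subset_trans)
qed

text \<open>By the assumption on \<open>b\<close>, a flag that has become False stays False. A final
  True therefore means that every step was idle, so each choice was processed on \<open>E0\<close>
  itself.\<close>

lemma pass_unchanged:
  assumes "pass ch b E0 ks seen flag E" and flag
    and "\<And>k fl A A'. b k (fl, A) (True, A') \<Longrightarrow> fl \<and> A' = A"
  shows "E = E0 \<and> seen = {E0} \<and> (\<forall>k \<in> ks. b k (True, E0) (True, E0))"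
  using assms(1,2)
proof induction
  case (step ks seen flag E k flag' E')
  then have "flag" "E' = E"
    using assms(3)[of k flag E E'] by auto
  then show ?case using step by auto
qed simp

text \<open>Only the last pass matters. There \<open>seen\<close> is a singleton, so the choices
  that must be processed are exactly those available in the output.\<close>

lemma returns_closed:
  assumes "returns ch b E0 R"
    and "\<And>k fl A A'. b k (fl, A) (True, A') \<Longrightarrow> fl \<and> A' = A"
  shows "\<forall>k \<in> ch R. b k (True, R) (True, R)"
  using assms(1)
proof induction
  case (stop E E')
  then obtain processed seen
    where p: "pass ch b E processed seen True E'" and "ch (\<Inter>seen) \<subseteq> processed"
    unfolding full_pass_def by blast
  moreover have "E' = E \<and> seen = {E} \<and> (\<forall>k \<in> processed. b k (True, E) (True, E))"
    by (rule pass_unchanged[OF p TrueI]) (rule assms(2))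
  ultimately show ?case by auto
qed

section \<open>Ordinary inference\<close>

text \<open>The least model of the rules over \<open>E\<close>: a reference point, free of schedules
  and flags, with which both algorithms are compared.\<close>

inductive_set derivable ::
  "('c, 'v, 'p) signature \<Rightarrow> ('c, 'v, 'p) rule set \<Rightarrow> ('c, 'v, 'p) pexpr set \<Rightarrow>
   ('c, 'v, 'p) pexpr set" for \<Sigma> IDB E where
  fact: "f \<in> E \<Longrightarrow> f \<in> derivable \<Sigma> IDB E"
| rule: "\<lbrakk> r \<in> IDB; \<gamma> \<in> assignments \<Sigma>;
           \<And>s. s \<in> set (prems r) \<Longrightarrow> inst \<gamma> s \<in> derivable \<Sigma> IDB E \<rbrakk>
         \<Longrightarrow> inst \<gamma> (head r) \<in> derivable \<Sigma> IDB E"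

lemma derivable_least:
  assumes "E \<subseteq> A"
    and "\<And>r \<gamma>. \<lbrakk> r \<in> IDB; \<gamma> \<in> assignments \<Sigma>; \<forall>s \<in> set (prems r). inst \<gamma> s \<in> A \<rbrakk>
           \<Longrightarrow> inst \<gamma> (head r) \<in> A"
  shows "derivable \<Sigma> IDB E \<subseteq> A"
proof
  fix f assume "f \<in> derivable \<Sigma> IDB E"
  then show "f \<in> A"
    by induction (use assms in auto)
qed

lemma mono_choices: "mono (choices \<Sigma> IDB)"
  by (rule monoI) (auto simp: choices_def)

lemma body_True_unchanged: "body k (fl, A) (True, A') \<Longrightarrow> fl \<and> A' = A"
  by (erule body.cases) auto

lemma body_subset: "body k (fl, A) (fl', A') \<Longrightarrow> A \<subseteq> A'"
  by (erule body.cases) auto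

lemma body_derivable:
  assumes "k \<in> choices \<Sigma> IDB (derivable \<Sigma> IDB E)" "A \<subseteq> derivable \<Sigma> IDB E"
    and "body k (fl, A) (fl', A')"
  shows "A' \<subseteq> derivable \<Sigma> IDB E"
  using assms(3)
proof cases
  case (add \<gamma> r fs)
  then have "inst \<gamma> (head r) \<in> derivable \<Sigma> IDB E"
    using assms(1) by (intro derivable.rule) (auto simp: choices_def)
  then show ?thesis using add assms(2) by simp
qed (use assms(2) in simp)

lemma returns_body_eq:
  assumes "returns (choices \<Sigma> IDB) body E R"
  shows "R = derivable \<Sigma> IDB E"
proof
  have "E \<subseteq> derivable \<Sigma> IDB E"
    by (auto intro: derivable.fact)
  then show "R \<subseteq> derivable \<Sigma> IDB E"
    by (rule returns_subset[OF assms mono_choices]) (rule body_derivable)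
  show "derivable \<Sigma> IDB E \<subseteq> R"
  proof (rule derivable_least)
    show "E \<subseteq> R"
      by (rule returns_mono[OF assms, where g = "\<lambda>A. A"]) (rule body_subset)
  next
    fix r \<gamma>
    assume "r \<in> IDB" "\<gamma> \<in> assignments \<Sigma>" "\<forall>s \<in> set (prems r). inst \<gamma> s \<in> R"
    then have "(r, \<gamma>, map (inst \<gamma>) (prems r)) \<in> choices \<Sigma> IDB R"
      by (auto simp: choices_def)
    moreover have "\<forall>k \<in> choices \<Sigma> IDB R. body k (True, R) (True, R)"
      by (rule returns_closed[OF assms]) (rule body_True_unchanged)
    ultimately have "body (r, \<gamma>, map (inst \<gamma>) (prems r)) (True, R) (True, R)"
      by blast
    \<comment> \<open>Adding a fact would clear the flag, so only the case where the head is already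
      present survives.\<close>
    then show "inst \<gamma> (head r) \<in> R"
      by cases auto
  qed
qed

section \<open>Termination of ordinary inference\<close>

lemma body_total: "\<exists>fl' A'. body k (fl, A) (fl', A')"
proof (cases k)
  case (fields r \<gamma> fs)
  then show ?thesis
    using body.present[of \<gamma> r A fs fl] body.add[of \<gamma> r A fs fl] by blast
qed

text \<open>The choices in \<open>K\<close> are processed one by one. Keeping \<open>E\<close> in
  \<open>seen\<close> ensures that each of them is still available when its turn comes.\<close>

lemma pass_exists:
  assumes "finite K" "K \<subseteq> ch E"
    and "mono ch"
    and "\<And>k fl A. \<exists>fl' A'. b k (fl, A) (fl', A')"
  shows "\<exists>seen fl E'. pass ch b E K seen fl E' \<and> E \<in> seen"
  using assms(1,2)
proof induction
  case empty
  then show ?case using pass.start[of ch b E] by blast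
next
  case (insert k K)
  then obtain seen fl E' where p: "pass ch b E K seen fl E'" and E: "E \<in> seen"
    by blast
  obtain fl' E'' where "b k (fl, E') (fl', E'')"
    using assms(4) by blast
  moreover have "k \<in> ch (\<Union>seen)"
    using insert(4) monoD[OF assms(3), of E "\<Union>seen"] E by blast
  ultimately show ?case
    using pass.step[OF p _ insert(2)] E by blast
qed

lemma full_pass_exists:
  assumes "finite (ch E)" "mono ch"
    and "\<And>k fl A. \<exists>fl' A'. b k (fl, A) (fl', A')"
  shows "\<exists>fl E'. full_pass ch b E fl E'"
proof -
  have "\<exists>seen fl E'. pass ch b E (ch E) seen fl E' \<and> E \<in> seen"
    by (rule pass_exists[OF assms(1) subset_refl assms(2)]) (rule assms(3))
  then obtain seen fl E' where "pass ch b E (ch E) seen fl E'" "E \<in> seen"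
    by blast
  \<comment> \<open>Since \<open>E\<close> is among the values seen, the facts present throughout
    the pass lie in \<open>E\<close>, so processing \<open>ch E\<close> meets the obligation of a
    full pass.\<close>
  moreover from this have "ch (\<Inter>seen) \<subseteq> ch E"
    by (intro monoD[OF assms(2)]) blast
  ultimately show ?thesis
    unfolding full_pass_def by blast
qed

text \<open>The flag is cleared only when a new fact is added, and no later step removes it.\<close>

lemma pass_body_False_psubset:
  assumes "pass ch body E0 ks seen flag E"
  shows "E0 \<subseteq> E \<and> (\<not> flag \<longrightarrow> E0 \<noteq> E)"
  using assms
proof induction
  case (step ks seen flag E k flag' E')
  from step(4) show ?case
    by cases (use step.IH in auto)
qed simp

lemma finite_assignments: "wf_signature \<Sigma> \<Longrightarrow> finite (assignments \<Sigma>)"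
  by (simp add: wf_signature_def assignments_def finite_PiE)

text \<open>The rule and the assignment determine the list of matched facts.\<close>

lemma finite_choices:
  assumes "wf_signature \<Sigma>" "finite IDB"
  shows "finite (choices \<Sigma> IDB E)"
proof (rule finite_subset)
  show "choices \<Sigma> IDB E \<subseteq>
      (\<lambda>(r, \<gamma>). (r, \<gamma>, map (inst \<gamma>) (prems r))) ` (IDB \<times> assignments \<Sigma>)"
    by (auto simp: choices_def)
qed (simp add: assms finite_assignments)

lemma finite_derivable:
  assumes "wf_signature \<Sigma>" "finite IDB" "finite E"
  shows "finite (derivable \<Sigma> IDB E)"
proof (rule finite_subset)
  show "derivable \<Sigma> IDB E \<subseteq> E \<union> (\<lambda>(r, \<gamma>). inst \<gamma> (head r)) ` (IDB \<times> assignments \<Sigma>)"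
    by (rule derivable_least) auto
qed (simp add: assms finite_assignments)

text \<open>The measure is the number of derivable facts still missing. A pass that ends with the
  flag cleared stays within the derivable facts and adds at least one.\<close>

lemma returns_body_exists:
  assumes "wf_signature \<Sigma>" "finite IDB" "finite E"
  shows "\<exists>R. returns (choices \<Sigma> IDB) body E R"
proof -
  let ?D = "derivable \<Sigma> IDB E"
  have "\<exists>R. returns (choices \<Sigma> IDB) body A R" if "A \<subseteq> ?D" for A
    using that
  proof (induction "card (?D - A)" arbitrary: A rule: less_induct)
    case less
    have "\<exists>fl A'. full_pass (choices \<Sigma> IDB) body A fl A'"
      by (rule full_pass_exists[OF finite_choices[OF assms(1,2)] mono_choices]) (rule body_total)
    then obtain fl A' where full: "full_pass (choices \<Sigma> IDB) body A fl A'"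
      by blast
    then obtain processed seen where p: "pass (choices \<Sigma> IDB) body A processed seen fl A'"
      unfolding full_pass_def by blast
    show ?case
    proof (cases fl)
      case True
      then show ?thesis using full by (auto intro: returns.stop)
    next
      case False
      have "A' \<subseteq> ?D \<and> \<Union>seen \<subseteq> ?D"
        by (rule pass_subset[OF p mono_choices less.prems]) (rule body_derivable)
      then have "A' \<subseteq> ?D" ..
      moreover have "A \<subset> A'"
        using pass_body_False_psubset[OF p] False by blast
      ultimately have "?D - A' \<subset> ?D - A"
        using less.prems by blast
      then have "card (?D - A') < card (?D - A)"
        by (intro psubset_card_mono) (simp_all add: finite_derivable[OF assms])
      then obtain R where "returns (choices \<Sigma> IDB) body A' R"
        using less.hyps \<open>A' \<subseteq> ?D\<close> by blast
      then show ?thesis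
        using full False by (auto intro: returns.again)
    qed
  qed
  moreover have "E \<subseteq> ?D"
    by (auto intro: derivable.fact)
  ultimately show ?thesis by blast
qed

lemma infer_eq_derivable:
  assumes "wf_signature \<Sigma>" "finite IDB" "finite E"
  shows "infer \<Sigma> IDB E = derivable \<Sigma> IDB E"
proof -
  obtain R where R: "returns (choices \<Sigma> IDB) body E R"
    using returns_body_exists[OF assms] by blast
  have "infer \<Sigma> IDB E = R"
    unfolding infer_def
  proof (rule the_equality)
    show "returns (choices \<Sigma> IDB) body E R" by (rule R)
  next
    fix R' assume "returns (choices \<Sigma> IDB) body E R'"
    then show "R' = R"
      by (simp only: returns_body_eq[OF R] returns_body_eq)
  qed
  then show ?thesis
    by (simp only: returns_body_eq[OF R])
qed

section \<open>Lifted inference\<close>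

text \<open>Evaluating at a point replaces the satisfiability test of \<open>restriction\<close> and
  commutes with the connectives, which satisfiability does not do for conjunction.\<close>

definition holds_in :: "'x set \<Rightarrow> ('f \<times> 'x pform) set \<Rightarrow> 'f set" where
  "holds_in \<rho> E = {f. \<exists>pc. (f, pc) \<in> E \<and> holds \<rho> pc}"

lemma holds_in_iff: "f \<in> holds_in \<rho> E \<longleftrightarrow> (\<exists>pc. (f, pc) \<in> E \<and> holds \<rho> pc)"
  by (simp add: holds_in_def)

lemma restriction_config_form:
  assumes "finite F" "\<rho> \<subseteq> F" "\<forall>lf \<in> E. atoms (snd lf) \<subseteq> F"
  shows "restriction E (config_form F \<rho>) = holds_in \<rho> E"
proof -
  have "sat (Conj pc (config_form F \<rho>)) \<longleftrightarrow> holds \<rho> pc" if "(f, pc) \<in> E" for f pc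
    using that assms(3) by (intro sat_Conj_config_form[OF assms(1,2)]) fastforce
  then show ?thesis
    unfolding restriction_def holds_in_def by blast
qed

lemma mono_lifted_choices: "mono (lifted_choices \<Sigma> IDB)"
  by (rule monoI) (auto simp: lifted_choices_def)

lemma lifted_body_True_unchanged: "lifted_body k (fl, A) (True, A') \<Longrightarrow> fl \<and> A' = A"
  by (erule lifted_body.cases) auto

lemma lifted_body_holds_in_mono:
  assumes "lifted_body k (fl, A) (fl', A')"
  shows "holds_in \<rho> A \<subseteq> holds_in \<rho> A'"
  using assms
proof cases
  case (merge pcc lfs C \<gamma> r pcd)
  show ?thesis
  proof
    fix f assume "f \<in> holds_in \<rho> A"
    then obtain pc where "(f, pc) \<in> A" "holds \<rho> pc"
      by (auto simp: holds_in_iff)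
    then show "f \<in> holds_in \<rho> A'"
      using merge by (cases "(f, pc) = (C, pcd)") (auto simp: holds_in_iff)
  qed
qed (auto simp: holds_in_iff)

text \<open>\<open>U\<close> turns soundness at \<open>\<rho>\<close> into a set of admissible
  lifted facts, the form that \<open>returns_subset\<close> expects. The bound on atoms is carried
  along so that the output can again be restricted to a configuration.\<close>

lemma lifted_body_sound:
  defines "U D F \<rho> \<equiv> {(f, pc). atoms pc \<subseteq> F \<and> (holds \<rho> pc \<longrightarrow> f \<in> D)}"
  assumes k: "k \<in> lifted_choices \<Sigma> IDB (U (derivable \<Sigma> IDB E) F \<rho>)"
    and A: "A \<subseteq> U (derivable \<Sigma> IDB E) F \<rho>"
    and body: "lifted_body k (fl, A) (fl', A')"
  shows "A' \<subseteq> U (derivable \<Sigma> IDB E) F \<rho>"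
proof -
  obtain r \<gamma> lfs where k_eq: "k = (r, \<gamma>, lfs)"
    by (cases k)
  have r: "r \<in> IDB" "\<gamma> \<in> assignments \<Sigma>"
    and lfs: "set lfs \<subseteq> U (derivable \<Sigma> IDB E) F \<rho>"
    and eq: "map (inst \<gamma>) (prems r) = map fst lfs"
    using k by (auto simp: k_eq lifted_choices_def)
  have "inst \<gamma> (head r) \<in> derivable \<Sigma> IDB E" if h: "holds \<rho> (conj_list (map snd lfs))"
  proof (rule derivable.rule[OF r])
    fix s assume "s \<in> set (prems r)"
    then have "inst \<gamma> s \<in> set (map fst lfs)"
      by (metis eq image_eqI set_map)
    then show "inst \<gamma> s \<in> derivable \<Sigma> IDB E"
      using lfs h by (force simp: holds_conj_list U_def)
  qed
  moreover have "atoms (conj_list (map snd lfs)) \<subseteq> F"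
    using lfs by (force simp: atoms_conj_list U_def)
  ultimately have new: "(inst \<gamma> (head r), conj_list (map snd lfs)) \<in> U (derivable \<Sigma> IDB E) F \<rho>"
    by (simp add: U_def)
  from body show ?thesis
    unfolding k_eq
  proof cases
    case (merge pcc C pcd)
    then have "(C, pcd) \<in> U (derivable \<Sigma> IDB E) F \<rho>"
      using A by blast
    \<comment> \<open>If the disjunction is true at \<open>\<rho>\<close>, so is the old or the new
      condition, and either one makes \<open>C\<close> derivable.\<close>
    then have "(C, Disj pcc pcd) \<in> U (derivable \<Sigma> IDB E) F \<rho>"
      using new merge by (auto simp: U_def)
    then show ?thesis using A merge by blast
  qed (use A new in auto)
qed

text \<open>This covers every terminating run: the invariant \<open>U\<close> bounds the output from
  above, and the idle last pass gives closure under the rules.\<close>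

lemma lifted_infer_holds_in:
  assumes "lifted_infer \<Sigma> IDB E R" and E: "\<forall>lf \<in> E. atoms (snd lf) \<subseteq> F"
  shows "holds_in \<rho> R = derivable \<Sigma> IDB (holds_in \<rho> E)"
    and "\<forall>lf \<in> R. atoms (snd lf) \<subseteq> F"
proof -
  let ?D = "derivable \<Sigma> IDB (holds_in \<rho> E)"
  have ret: "returns (lifted_choices \<Sigma> IDB) lifted_body E R"
    using assms(1) by (simp add: lifted_infer_def)
  have "E \<subseteq> {(f, pc). atoms pc \<subseteq> F \<and> (holds \<rho> pc \<longrightarrow> f \<in> ?D)}"
    using E by (force simp: holds_in_iff intro: derivable.fact)
  then have R: "R \<subseteq> {(f, pc). atoms pc \<subseteq> F \<and> (holds \<rho> pc \<longrightarrow> f \<in> ?D)}"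
    by (rule returns_subset[OF ret mono_lifted_choices]) (rule lifted_body_sound)
  then show "\<forall>lf \<in> R. atoms (snd lf) \<subseteq> F"
    by fastforce
  show "holds_in \<rho> R = ?D"
  proof
    show "holds_in \<rho> R \<subseteq> ?D"
      using R by (auto simp: holds_in_iff)
    show "?D \<subseteq> holds_in \<rho> R"
    proof (rule derivable_least)
      show "holds_in \<rho> E \<subseteq> holds_in \<rho> R"
        by (rule returns_mono[OF ret]) (rule lifted_body_holds_in_mono)
    next
      fix r \<gamma>
      assume r: "r \<in> IDB" "\<gamma> \<in> assignments \<Sigma>" and "\<forall>s \<in> set (prems r). inst \<gamma> s \<in> holds_in \<rho> R"
      \<comment> \<open>A fact may carry several presence conditions; one that is true at
        \<open>\<rho>\<close> is chosen for each premise.\<close>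
      then obtain pc where pc: "\<forall>s \<in> set (prems r). (inst \<gamma> s, pc s) \<in> R \<and> holds \<rho> (pc s)"
        unfolding holds_in_iff by metis
      define lfs where "lfs = map (\<lambda>s. (inst \<gamma> s, pc s)) (prems r)"
      have "(r, \<gamma>, lfs) \<in> lifted_choices \<Sigma> IDB R"
        using r pc by (auto simp: lifted_choices_def lfs_def)
      moreover have "\<forall>k \<in> lifted_choices \<Sigma> IDB R. lifted_body k (True, R) (True, R)"
        by (rule returns_closed[OF ret]) (rule lifted_body_True_unchanged)
      ultimately have "lifted_body (r, \<gamma>, lfs) (True, R) (True, R)"
        by blast
      moreover have "holds \<rho> (conj_list (map snd lfs))"
        using pc by (auto simp: holds_conj_list lfs_def)
      \<comment> \<open>The flag rules out \<open>merge\<close> and \<open>add\<close>, and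
        \<open>\<rho>\<close> itself satisfies the conjunction, which rules out
        \<open>unsat\<close>. What remains is that the head occurs in \<open>R\<close> with this
        conjunction.\<close>
      ultimately show "inst \<gamma> (head r) \<in> holds_in \<rho> R"
        by cases (auto simp: sat_def holds_in_iff)
    qed
  qed
qed

theorem theorem1:
  fixes L :: "('x, 'd) product_line"
    and \<Sigma> :: "('c, 'v, 'p) signature"
    and IDB :: "('c, 'v, 'p) rule set"
    and EDB R :: "('c, 'v, 'p, 'x) lifted_fact set"
    and \<rho> :: "'x set"
  assumes "wf_product_line L"
    and "wf_signature \<Sigma>"
    and "finite IDB" and "\<forall>r \<in> IDB. wf_rule \<Sigma> r"
    and "finite EDB" and "\<forall>lf \<in> EDB. wf_lifted_fact \<Sigma> (features L) lf"
    and "lifted_infer \<Sigma> IDB EDB R"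
    and "\<rho> \<in> Conf L"
  shows "restriction R (config_form (features L) \<rho>) =
         infer \<Sigma> IDB (restriction EDB (config_form (features L) \<rho>))"
proof -
  have F: "finite (features L)" and \<rho>: "\<rho> \<subseteq> features L"
    using assms(1,8) by (simp_all add: wf_product_line_def Conf_def)
  have EDB: "\<forall>lf \<in> EDB. atoms (snd lf) \<subseteq> features L"
    using assms(6) by (simp add: wf_lifted_fact_def)
  have "holds_in \<rho> EDB \<subseteq> fst ` EDB"
    by (force simp: holds_in_iff)
  then have "finite (holds_in \<rho> EDB)"
    using assms(5) finite_surj by blast
  then show ?thesis
    by (simp add: restriction_config_form[OF F \<rho>] EDB lifted_infer_holds_in[OF assms(7) EDB]
        infer_eq_derivable[OF assms(2,3)])
qed

end
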